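(* Let $G=\{P_1,\ldots,P_r\}$ be a system of (non-zero) generators of a non-zero left ideal $I\subset A_n(\mathbf{k})$. If $G$ is a Gröbner base of $I$ with respect to $<$, then $G$ is a Gröbner $\delta$-base of $I$ with respect to $<_\partial$.
   Context: $\mathbf{k}$ is a field of characteristic zero, $\mathcal{H}=\mathbf{k}[X]=\mathbf{k}[x_1,\ldots,x_n]$, and $A_n(\mathbf{k})=\mathbf{k}[X][\partial_1,\ldots,\partial_n]$ is the Weyl algebra. $X^\alpha\partial^\beta$ denotes $x_1^{\alpha_1}\cdots x_n^{\alpha_n}\partial_1^{\beta_1}\cdots\partial_n^{\beta_n}$. $<_x$ and $<_\partial$ are monomial orderings on $\mathbb{N}^n$ (total well-orderings compatible with addition). On $\mathbb{N}^n\times\mathbb{N}^n$ the monomial ordering $<$ is defined by: $(\alpha(1),\beta(1))<(\alpha(2),\beta(2))$ iff $\beta(1)<_\partial\beta(2)$, or $\beta(1)=\beta(2)$ and $\alpha(1)<_x\alpha(2)$. Gröbner base: for non-zero $P=\sum p_{\alpha\beta}X^\alpha\partial^\beta\in A_n(\mathbf{k})$ with $p_{\alpha\beta}\in\mathbf{k}$, $\exp_<(P)=\max_<\{(\alpha,\beta):p_{\alpha\beta}\neq0\}\in\mathbb{N}^{2n}$. A finite family $\{P_1,\ldots,P_r\}\subset I$ of non-zero operators is a Gröbner base of $I$ with respect to $<$ if $\{\exp_<(P):P\in I\setminus\{0\}\}=\bigcup_{i=1}^r(\exp_<(P_i)+\mathbb{N}^{2n})$. Gröbner $\delta$-base: for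 non-zero $P=\sum_\beta p_\beta\partial^\beta$ with $p_\beta\in\mathcal{H}$, let $\exp^\delta(P)=\max_{<_\partial}\{\beta:p_\beta\ne0\}$, $c^\delta(P)=p_{\exp^\delta(P)}$, and $in^\delta(P)=c^\delta(P)\zeta^{\exp^\delta(P)}$ in the commutative polynomial ring $\mathcal{H}[\zeta]=\mathcal{H}[\zeta_1,\ldots,\zeta_n]$. A finite family $\{P_1,\ldots,P_r\}\subset I$ of non-zero operators is a Gröbner $\delta$-base of $I$ with respect to $<_\partial$ if the ideal of $\mathcal{H}[\zeta]$ generated by $\{in^\delta(P):P\in I\setminus\{0\}\}$ is generated by $in^\delta(P_1),\ldots,in^\delta(P_r)$. *)

theory Defs
  imports
    Complex_Main
    "HOL-Library.Poly_Mapping"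
    "HOL-Library.Function_Algebras"
    "HOL-Library.Product_Plus"
    "HOL-Library.FuncSet"
begin

section \<open>Polynomials\<close>

text \<open>
  The index type \<open>'n\<close> is finite with \<open>n\<close> elements, \<open>'n \<Rightarrow> nat\<close> is the monoid of
  exponents, and \<open>('k, 'n) mpoly\<close> is the polynomial ring \<open>k[x\<^sub>i | i \<in> 'n]\<close>, with
  \<open>Poly_Mapping.single \<alpha> c\<close> standing for \<open>c X\<^sup>\<alpha>\<close>.
\<close>

type_synonym ('k, 'n) mpoly = "('n \<Rightarrow> nat) \<Rightarrow>\<^sub>0 'k"

text \<open>
  \<open>('k, 'n) mpoly2\<close> is the commutative ring \<open>k[X][\<zeta>]\<close>; the outer exponent belongs to \<open>\<zeta>\<close>.
\<close>

type_synonym ('k, 'n) mpoly2 = "('n \<Rightarrow> nat) \<Rightarrow>\<^sub>0 ('k, 'n) mpoly"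

definition mfact :: "('n::finite \<Rightarrow> nat) \<Rightarrow> nat" where
  "mfact \<sigma> = (\<Prod>i\<in>UNIV. fact (\<sigma> i))"

definition mchoose :: "('n::finite \<Rightarrow> nat) \<Rightarrow> ('n \<Rightarrow> nat) \<Rightarrow> nat" where
  "mchoose \<mu> \<sigma> = (\<Prod>i\<in>UNIV. \<mu> i choose \<sigma> i)"

text \<open>
  The iterated partial derivative of order \<open>\<sigma>\<close>, sending \<open>X\<^sup>\<mu>\<close> to \<open>\<sigma>! (\<mu> choose \<sigma>) X\<^bsup>\<mu>-\<sigma>\<^esup>\<close>.
  The subtraction is truncated, but the coefficient vanishes unless \<open>\<sigma> \<le> \<mu>\<close>.
\<close>

definition pdiff :: "('n::finite \<Rightarrow> nat) \<Rightarrow> ('k::field_char_0, 'n) mpoly \<Rightarrow> ('k, 'n) mpoly" where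
  "pdiff \<sigma> g = (\<Sum>\<mu>\<in>Poly_Mapping.keys g.
     Poly_Mapping.single (\<mu> - \<sigma>) (of_nat (mfact \<sigma> * mchoose \<mu> \<sigma>) * Poly_Mapping.lookup g \<mu>))"


section \<open>The Weyl algebra\<close>

text \<open>
  An operator \<open>P = \<Sum>\<^sub>\<beta> p\<^sub>\<beta> \<partial>\<^sup>\<beta>\<close> is given by its family \<open>dcoeffs P\<close> of coefficients
  \<open>p\<^sub>\<beta> \<in> k[X]\<close>. The product is determined by
  \<open>(f \<partial>\<^sup>\<beta>) (g \<partial>\<^sup>\<gamma>) = \<Sum>\<^bsub>\<sigma>\<le>\<beta>\<^esub> (\<beta> choose \<sigma>) f \<partial>\<^sup>\<sigma>(g) \<partial>\<^bsup>\<beta>-\<sigma>+\<gamma>\<^esup>\<close>.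
\<close>

typedef (overloaded) ('k::field_char_0, 'n::finite) weyl = "UNIV :: ('k, 'n) mpoly2 set"
  morphisms dcoeffs Weyl
  by simp

lemma dcoeffs_Weyl [simp]: "dcoeffs (Weyl p) = p"
  by (simp add: Weyl_inverse)

instantiation weyl :: (field_char_0, finite) "{zero, one, plus, minus, uminus, times}"
begin

definition "0 = Weyl 0"
definition "1 = Weyl 1"
definition "P + Q = Weyl (dcoeffs P + dcoeffs Q)"
definition "P - Q = Weyl (dcoeffs P - dcoeffs Q)"
definition "- P = Weyl (- dcoeffs P)"
definition "P * Q = Weyl
  (\<Sum>\<beta>\<in>Poly_Mapping.keys (dcoeffs P). \<Sum>\<gamma>\<in>Poly_Mapping.keys (dcoeffs Q). \<Sum>\<sigma>\<in>{..\<beta>}.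
     Poly_Mapping.single (\<beta> - \<sigma> + \<gamma>)
       (of_nat (mchoose \<beta> \<sigma>) * Poly_Mapping.lookup (dcoeffs P) \<beta>
          * pdiff \<sigma> (Poly_Mapping.lookup (dcoeffs Q) \<gamma>)))"

instance ..

end


subsection \<open>The action on polynomials\<close>

text \<open>
  The action of differential operators on \<open>k[X]\<close> is faithful in characteristic zero, and the
  ring axioms follow from those of composition.
\<close>

definition act :: "('k::field_char_0, 'n::finite) weyl \<Rightarrow> ('k, 'n) mpoly \<Rightarrow> ('k, 'n) mpoly" where
  "act P f = (\<Sum>\<beta>\<in>Poly_Mapping.keys (dcoeffs P). Poly_Mapping.lookup (dcoeffs P) \<beta> * pdiff \<beta> f)"

lemma sum_keys_superset:
  fixes h :: "'a \<Rightarrow> 'b::zero \<Rightarrow> 'c::comm_monoid_add"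
  assumes "\<And>k. h k 0 = 0" "finite A" "Poly_Mapping.keys p \<subseteq> A"
  shows "(\<Sum>k\<in>Poly_Mapping.keys p. h k (Poly_Mapping.lookup p k))
       = (\<Sum>k\<in>A. h k (Poly_Mapping.lookup p k))"
  by (rule sum.mono_neutral_left) (use assms in \<open>auto simp: in_keys_iff\<close>)

lemma sum_keys_add:
  fixes h :: "'a \<Rightarrow> 'b::comm_monoid_add \<Rightarrow> 'c::comm_monoid_add"
  assumes 0: "\<And>k. h k 0 = 0" and add: "\<And>k a b. h k (a + b) = h k a + h k b"
  shows "(\<Sum>k\<in>Poly_Mapping.keys (p + q). h k (Poly_Mapping.lookup (p + q) k))
       = (\<Sum>k\<in>Poly_Mapping.keys p. h k (Poly_Mapping.lookup p k))
         + (\<Sum>k\<in>Poly_Mapping.keys q. h k (Poly_Mapping.lookup q k))"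
proof -
  let ?A = "Poly_Mapping.keys p \<union> Poly_Mapping.keys q"
  have A: "finite ?A" by simp
  show ?thesis
    using sum_keys_superset[of h, OF 0 A, of "p + q"] sum_keys_superset[of h, OF 0 A, of p]
      sum_keys_superset[of h, OF 0 A, of q] Poly_Mapping.keys_add[of p q]
    by (simp add: lookup_add add sum.distrib)
qed

lemma sum_keys_single:
  fixes h :: "'a \<Rightarrow> 'b::zero \<Rightarrow> 'c::comm_monoid_add"
  assumes "\<And>k. h k 0 = 0"
  shows "(\<Sum>k\<in>Poly_Mapping.keys (Poly_Mapping.single a c).
            h k (Poly_Mapping.lookup (Poly_Mapping.single a c) k)) = h a c"
  using assms by (cases "c = 0") auto

lemma sum_single_keys:
  fixes p :: "'a \<Rightarrow>\<^sub>0 'b::comm_monoid_add"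
  shows "(\<Sum>k\<in>Poly_Mapping.keys p. Poly_Mapping.single k (Poly_Mapping.lookup p k)) = p"
  by (rule poly_mapping_eqI)
     (auto simp: lookup_sum lookup_single when_def sum.delta in_keys_iff)

lemma single_sum:
  "Poly_Mapping.single k (sum h A) = (\<Sum>a\<in>A. Poly_Mapping.single k (h a))"
  by (induction A rule: infinite_finite_induct) (simp_all add: single_add)

lemma pm_induct [case_names zero add single]:
  fixes p :: "'a \<Rightarrow>\<^sub>0 'b::comm_monoid_add"
  assumes "R 0" "\<And>p q. R p \<Longrightarrow> R q \<Longrightarrow> R (p + q)" "\<And>a c. R (Poly_Mapping.single a c)"
  shows "R p"
proof -
  have "R (\<Sum>k\<in>A. Poly_Mapping.single k (Poly_Mapping.lookup p k))" for A
    by (induction A rule: infinite_finite_induct) (use assms in auto)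
  from this[of "Poly_Mapping.keys p"] show ?thesis by (simp add: sum_single_keys)
qed

lemma finite_atMost_fun: "finite {..\<beta> :: 'n::finite \<Rightarrow> nat}"
proof -
  have "{..\<beta>} = (\<Pi>\<^sub>E i\<in>UNIV. {..\<beta> i})" by (auto simp: le_fun_def PiE_def Pi_def)
  then show ?thesis by (simp add: finite_PiE)
qed

lemma mchoose_eq_0: "mchoose \<mu> \<sigma> = 0 \<longleftrightarrow> \<not> \<sigma> \<le> \<mu>"
  by (auto simp: mchoose_def le_fun_def not_le)

lemma pdiff_0 [simp]: "pdiff \<sigma> 0 = 0"
  by (simp add: pdiff_def)

lemma pdiff_add: "pdiff \<sigma> (f + g) = pdiff \<sigma> f + pdiff \<sigma> g"
  unfolding pdiff_def by (rule sum_keys_add) (simp_all add: distrib_left single_add)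

lemma pdiff_single:
  "pdiff \<sigma> (Poly_Mapping.single \<mu> c)
     = Poly_Mapping.single (\<mu> - \<sigma>) (of_nat (mfact \<sigma> * mchoose \<mu> \<sigma>) * c)"
  unfolding pdiff_def by (rule sum_keys_single) simp

lemma pdiff_sum: "pdiff \<sigma> (sum f A) = (\<Sum>a\<in>A. pdiff \<sigma> (f a))"
  by (induction A rule: infinite_finite_induct) (simp_all add: pdiff_add)

lemma pdiff_zero_order [simp]: "pdiff 0 f = f"
  by (induction f rule: pm_induct)
     (simp_all add: pdiff_add pdiff_single mfact_def mchoose_def fun_diff_def)

lemma choose_shift:
  "fact a * ((m - b) choose a) * (fact b * (m choose b)) = fact (a + b) * (m choose (a + b :: nat))"
proof (cases "a + b \<le> m")
  case True
  have "fact a * ((m - b) choose a) * (fact b * (m choose b)) * fact (m - (a + b))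
      = fact b * (m choose b) * (fact a * fact (m - b - a) * ((m - b) choose a))"
    by (simp add: add.commute)
  also have "\<dots> = fact b * fact (m - b) * (m choose b)"
    using True by (subst binomial_fact_lemma) auto
  also have "\<dots> = fact m"
    using True by (subst binomial_fact_lemma) auto
  also have "\<dots> = fact (a + b) * fact (m - (a + b)) * (m choose (a + b))"
    using True by (subst binomial_fact_lemma) auto
  finally show ?thesis by (simp add: mult_ac)
next
  case False
  then show ?thesis by (cases "b \<le> m") (auto simp: binomial_eq_0)
qed

lemma pdiff_pdiff: "pdiff \<alpha> (pdiff \<beta> f) = pdiff (\<alpha> + \<beta>) f"
proof (induction f rule: pm_induct)
  case (single \<mu> c)
  have "mfact \<alpha> * mchoose (\<mu> - \<beta>) \<alpha> * (mfact \<beta> * mchoose \<mu> \<beta>)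
      = mfact (\<alpha> + \<beta>) * mchoose \<mu> (\<alpha> + \<beta>)"
    unfolding mfact_def mchoose_def prod.distrib[symmetric] fun_diff_def plus_fun_def
    by (rule prod.cong) (simp_all only: choose_shift)
  moreover have "\<mu> - \<beta> - \<alpha> = \<mu> - (\<alpha> + \<beta>)"
    by (auto simp: fun_eq_iff)
  ultimately show ?case
    unfolding pdiff_single mult.assoc[symmetric] of_nat_mult[symmetric]
    by (simp only:)
qed (simp_all add: pdiff_add)

lemma vandermonde_fact:
  "(\<Sum>k\<le>r. (r choose k) * (fact k * (m choose k)) * (fact (r - k) * (n choose (r - k))))
     = fact r * ((m + n) choose (r :: nat))"
proof -
  have "(r choose k) * (fact k * (m choose k)) * (fact (r - k) * (n choose (r - k)))
      = fact r * ((m choose k) * (n choose (r - k)))" if "k \<le> r" for k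
  proof -
    have "(r choose k) * (fact k * (m choose k)) * (fact (r - k) * (n choose (r - k)))
        = (fact k * fact (r - k) * (r choose k)) * ((m choose k) * (n choose (r - k)))"
      by (simp add: mult_ac)
    then show ?thesis using that by (simp only: binomial_fact_lemma)
  qed
  then have "(\<Sum>k\<le>r. (r choose k) * (fact k * (m choose k)) * (fact (r - k) * (n choose (r - k))))
      = (\<Sum>k\<le>r. fact r * ((m choose k) * (n choose (r - k))))"
    by (intro sum.cong) auto
  then show ?thesis
    by (simp only: vandermonde[symmetric] sum_distrib_left)
qed

lemma mvandermonde_fact:
  "(\<Sum>\<sigma>\<in>{..\<beta>}. mchoose \<beta> \<sigma> * (mfact \<sigma> * mchoose \<mu> \<sigma>) * (mfact (\<beta> - \<sigma>) * mchoose \<nu> (\<beta> - \<sigma>)))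
     = mfact \<beta> * mchoose (\<mu> + \<nu>) \<beta>"
proof -
  have *: "{..\<beta>} = (\<Pi>\<^sub>E i\<in>UNIV. {..\<beta> i})" by (auto simp: le_fun_def PiE_def Pi_def)
  show ?thesis
    unfolding * mchoose_def mfact_def prod.distrib[symmetric] fun_diff_def plus_fun_def
      vandermonde_fact[symmetric]
    by (rule prod_sum_PiE[symmetric]) auto
qed

lemma pdiff_mult:
  "pdiff \<beta> (f * g) = (\<Sum>\<sigma>\<in>{..\<beta>}. of_nat (mchoose \<beta> \<sigma>) * pdiff \<sigma> f * pdiff (\<beta> - \<sigma>) g)"
proof (induction f rule: pm_induct)
  case (single \<mu> c)
  show ?case
  proof (induction g rule: pm_induct)
    case (single \<nu> d)
    have "of_nat (mchoose \<beta> \<sigma>) * pdiff \<sigma> (Poly_Mapping.single \<mu> c)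
            * pdiff (\<beta> - \<sigma>) (Poly_Mapping.single \<nu> d)
        = Poly_Mapping.single (\<mu> + \<nu> - \<beta>) (of_nat (mchoose \<beta> \<sigma> * (mfact \<sigma> * mchoose \<mu> \<sigma>)
            * (mfact (\<beta> - \<sigma>) * mchoose \<nu> (\<beta> - \<sigma>))) * (c * d))" if "\<sigma> \<le> \<beta>" for \<sigma>
    proof (cases "\<sigma> \<le> \<mu> \<and> \<beta> - \<sigma> \<le> \<nu>")
      case True
      have "\<mu> - \<sigma> + (\<nu> - (\<beta> - \<sigma>)) = \<mu> + \<nu> - \<beta>"
      proof (rule ext)
        fix i
        have "\<sigma> i \<le> \<mu> i" "\<beta> i - \<sigma> i \<le> \<nu> i" "\<sigma> i \<le> \<beta> i"
          using that True by (auto simp: le_fun_def)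
        then show "(\<mu> - \<sigma> + (\<nu> - (\<beta> - \<sigma>))) i = (\<mu> + \<nu> - \<beta>) i"
          unfolding fun_diff_def plus_fun_def by arith
      qed
      then show ?thesis
        by (simp add: pdiff_single mult_single mult_ac single_of_nat[symmetric] del: single_of_nat)
    next
      case False
      then have "mchoose \<mu> \<sigma> = 0 \<or> mchoose \<nu> (\<beta> - \<sigma>) = 0"
        by (auto simp: mchoose_eq_0)
      then show ?thesis by (auto simp: pdiff_single)
    qed
    then have "(\<Sum>\<sigma>\<in>{..\<beta>}. of_nat (mchoose \<beta> \<sigma>) * pdiff \<sigma> (Poly_Mapping.single \<mu> c)
            * pdiff (\<beta> - \<sigma>) (Poly_Mapping.single \<nu> d))
      = (\<Sum>\<sigma>\<in>{..\<beta>}. Poly_Mapping.single (\<mu> + \<nu> - \<beta>) (of_nat (mchoose \<beta> \<sigma> * (mfact \<sigma> * mchoose \<mu> \<sigma>)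
            * (mfact (\<beta> - \<sigma>) * mchoose \<nu> (\<beta> - \<sigma>))) * (c * d)))"
      by (intro sum.cong) auto
    also have "\<dots> = Poly_Mapping.single (\<mu> + \<nu> - \<beta>) (of_nat (\<Sum>\<sigma>\<in>{..\<beta>}. mchoose \<beta> \<sigma>
            * (mfact \<sigma> * mchoose \<mu> \<sigma>) * (mfact (\<beta> - \<sigma>) * mchoose \<nu> (\<beta> - \<sigma>))) * (c * d))"
      by (simp only: of_nat_sum sum_distrib_right single_sum)
    also have "\<dots> = pdiff \<beta> (Poly_Mapping.single \<mu> c * Poly_Mapping.single \<nu> d)"
      by (simp only: mvandermonde_fact mult_single pdiff_single)
    finally show ?case ..
  qed (simp_all add: pdiff_add distrib_left sum.distrib)
qed (simp_all add: pdiff_add distrib_left distrib_right sum.distrib)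

lemma act_0 [simp]: "act 0 f = 0"
  by (simp add: act_def zero_weyl_def)

lemma act_0_right [simp]: "act P 0 = 0"
  by (simp add: act_def)

lemma act_add: "act (P + Q) f = act P f + act Q f"
  unfolding act_def plus_weyl_def dcoeffs_Weyl
  by (rule sum_keys_add) (simp_all add: distrib_right)

lemma act_add_right: "act P (f + g) = act P f + act P g"
  by (simp add: act_def pdiff_add distrib_left sum.distrib)

lemma act_single: "act (Weyl (Poly_Mapping.single \<beta> p)) f = p * pdiff \<beta> f"
  unfolding act_def dcoeffs_Weyl by (rule sum_keys_single) simp

lemma act_sum: "act (Weyl (sum h A)) f = (\<Sum>a\<in>A. act (Weyl (h a)) f)"
proof (induction A rule: infinite_finite_induct)
  case (insert a A)
  then show ?case
    using act_add[of "Weyl (h a)" "Weyl (sum h A)" f] by (simp add: plus_weyl_def)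
qed (simp_all flip: zero_weyl_def)

lemma act_one [simp]: "act 1 f = f"
  using act_single[of 0 1 f] by (simp add: one_weyl_def)

lemma act_mult: "act (P * Q) f = act P (act Q f)"
proof -
  have "act (P * Q) f = (\<Sum>\<beta>\<in>Poly_Mapping.keys (dcoeffs P). \<Sum>\<gamma>\<in>Poly_Mapping.keys (dcoeffs Q).
      \<Sum>\<sigma>\<in>{..\<beta>}. of_nat (mchoose \<beta> \<sigma>) * Poly_Mapping.lookup (dcoeffs P) \<beta>
          * pdiff \<sigma> (Poly_Mapping.lookup (dcoeffs Q) \<gamma>) * pdiff (\<beta> - \<sigma> + \<gamma>) f)"
    by (simp only: times_weyl_def act_sum act_single)
  also have "\<dots> = act P (act Q f)"
    unfolding act_def pdiff_sum pdiff_mult pdiff_pdiff sum_distrib_left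
    by (intro sum.cong) (simp_all only: mult_ac)
  finally show ?thesis .
qed

lemma act_eq_0_imp:
  fixes P :: "('k::field_char_0, 'n::finite) weyl"
  assumes "\<And>f. act P f = 0"
  shows "P = 0"
proof (rule ccontr)
  assume "P \<noteq> 0"
  let ?K = "Poly_Mapping.keys (dcoeffs P)"
  let ?deg = "\<lambda>\<beta>. \<Sum>i\<in>UNIV. \<beta> i :: nat"
  have "?K \<noteq> {}"
    using \<open>P \<noteq> 0\<close> by (metis dcoeffs_inverse keys_eq_empty zero_weyl_def)
  then obtain \<beta> where \<beta>: "\<beta> \<in> ?K" "\<And>\<gamma>. \<gamma> \<in> ?K \<Longrightarrow> ?deg \<beta> \<le> ?deg \<gamma>"
    using ex_has_least_nat[of "\<lambda>\<beta>. \<beta> \<in> ?K" _ ?deg] by blast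
  let ?x = "Poly_Mapping.single \<beta> 1"
  have 0: "pdiff \<gamma> ?x = 0" if "\<gamma> \<in> ?K" "\<gamma> \<noteq> \<beta>" for \<gamma>
  proof -
    have "\<not> \<gamma> \<le> \<beta>"
    proof
      assume le: "\<gamma> \<le> \<beta>"
      obtain i where "\<gamma> i < \<beta> i"
        using le \<open>\<gamma> \<noteq> \<beta>\<close> by (metis le_fun_def le_neq_implies_less ext)
      then have "?deg \<gamma> < ?deg \<beta>"
        using le by (intro sum_strict_mono_ex1) (auto simp: le_fun_def)
      with \<beta>(2)[OF that(1)] show False by simp
    qed
    then show ?thesis by (simp add: pdiff_single flip: mchoose_eq_0)
  qed
  have "act P ?x = (\<Sum>\<gamma>\<in>{\<beta>}. Poly_Mapping.lookup (dcoeffs P) \<gamma> * pdiff \<gamma> ?x)"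
    unfolding act_def
  proof (rule sum.mono_neutral_right)
    show "\<forall>\<gamma>\<in>?K - {\<beta>}. Poly_Mapping.lookup (dcoeffs P) \<gamma> * pdiff \<gamma> ?x = 0"
      using 0 by (metis DiffE insertCI mult_zero_right)
  qed (use \<beta>(1) in auto)
  also have "\<dots> = Poly_Mapping.lookup (dcoeffs P) \<beta> * of_nat (mfact \<beta>)"
    by (simp add: pdiff_single mchoose_def single_of_nat fun_diff_def flip: zero_fun_def)
  finally have eq: "Poly_Mapping.lookup (dcoeffs P) \<beta> * of_nat (mfact \<beta>) = 0"
    using assms by simp
  let ?a = "Poly_Mapping.lookup (dcoeffs P) \<beta>"
  let ?c = "1 / of_nat (mfact \<beta>) :: 'k"
  have "mfact \<beta> \<noteq> 0"
    by (simp add: mfact_def)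
  then have 1: "of_nat (mfact \<beta>) * ?c = 1"
    by simp
  have "of_nat (mfact \<beta>) * Poly_Mapping.single 0 ?c
      = (Poly_Mapping.single 0 (of_nat (mfact \<beta>) * ?c) :: ('k, 'n) mpoly)"
    by (simp only: single_of_nat[symmetric] mult_single add_0)
  then have 2: "of_nat (mfact \<beta>) * Poly_Mapping.single 0 ?c = (1 :: ('k, 'n) mpoly)"
    by (simp only: 1 single_one)
  have "?a = ?a * (of_nat (mfact \<beta>) * Poly_Mapping.single 0 ?c)"
    by (simp only: 2 mult_1_right)
  also have "\<dots> = 0"
    by (simp only: mult.assoc[symmetric] eq mult_zero_left)
  finally have "?a = 0" .
  with \<beta>(1) show False by (simp add: in_keys_iff)
qed

lemma act_eqI:
  assumes "\<And>f. act P f = act Q f"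
  shows "P = Q"
proof -
  have "P - Q + Q = P"
    by (simp add: plus_weyl_def minus_weyl_def dcoeffs_inverse)
  then have "act (P - Q) f = 0" for f
    using act_add[of "P - Q" Q f] assms[of f] by simp
  then have "P - Q = 0" by (rule act_eq_0_imp)
  then have "dcoeffs P - dcoeffs Q = 0"
    by (metis dcoeffs_Weyl minus_weyl_def zero_weyl_def)
  then show ?thesis by (simp add: dcoeffs_inject)
qed

instance weyl :: (field_char_0, finite) ring_1
proof
  fix a b c :: "('a, 'b) weyl"
  show "a * b * c = a * (b * c)" "1 * a = a" "a * 1 = a"
    "(a + b) * c = a * c + b * c" "a * (b + c) = a * b + a * c"
    by (rule act_eqI; simp add: act_mult act_add act_add_right)+
  show "(0 :: ('a, 'b) weyl) \<noteq> 1"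
    by (simp add: zero_weyl_def one_weyl_def Weyl_inject)
qed (simp_all add: plus_weyl_def minus_weyl_def uminus_weyl_def zero_weyl_def add_ac dcoeffs_inverse)


subsection \<open>Generators and normal forms\<close>

definition unit_exp :: "'n \<Rightarrow> 'n \<Rightarrow> nat" where
  "unit_exp i = (\<lambda>j. if j = i then 1 else 0)"

text \<open>The operator \<open>c X\<^sup>\<alpha> \<partial>\<^sup>\<beta>\<close>.\<close>

definition wterm :: "'k::field_char_0 \<Rightarrow> ('n::finite \<Rightarrow> nat) \<Rightarrow> ('n \<Rightarrow> nat) \<Rightarrow> ('k, 'n) weyl" where
  "wterm c \<alpha> \<beta> = Weyl (Poly_Mapping.single \<beta> (Poly_Mapping.single \<alpha> c))"

abbreviation wx :: "'n::finite \<Rightarrow> ('k::field_char_0, 'n) weyl" where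
  "wx i \<equiv> wterm 1 (unit_exp i) 0"

abbreviation wd :: "'n::finite \<Rightarrow> ('k::field_char_0, 'n) weyl" where
  "wd i \<equiv> wterm 1 0 (unit_exp i)"

definition wcoeff :: "('k::field_char_0, 'n::finite) weyl \<Rightarrow> ('n \<Rightarrow> nat) \<times> ('n \<Rightarrow> nat) \<Rightarrow> 'k" where
  "wcoeff P = (\<lambda>(\<alpha>, \<beta>). Poly_Mapping.lookup (Poly_Mapping.lookup (dcoeffs P) \<beta>) \<alpha>)"

lemma act_wterm: "act (wterm c \<alpha> \<beta>) f = Poly_Mapping.single \<alpha> c * pdiff \<beta> f"
  by (simp add: wterm_def act_single)

lemma wterm_one: "wterm 1 0 0 = 1"
  by (simp add: wterm_def one_weyl_def)

lemma wterm_add: "wterm (c + d) \<alpha> \<beta> = wterm c \<alpha> \<beta> + wterm d \<alpha> \<beta>"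
  by (simp add: wterm_def plus_weyl_def single_add)

lemma wterm_eq_scalar_mult: "wterm c \<alpha> \<beta> = wterm c 0 0 * wterm 1 \<alpha> \<beta>"
  by (rule act_eqI) (simp add: act_mult act_wterm mult.assoc[symmetric] mult_single)

lemma wterm_scalar_commute: "wterm c 0 0 * P = P * wterm c 0 0"
proof (rule act_eqI)
  fix f
  have "pdiff \<beta> (Poly_Mapping.single 0 c * f) = Poly_Mapping.single 0 c * pdiff \<beta> f"
    for \<beta> :: "'b \<Rightarrow> nat"
  proof (induction f rule: pm_induct)
    case (add p q)
    then show ?case by (simp only: distrib_left pdiff_add)
  next
    case (single \<mu> d)
    show ?case by (simp only: mult_single pdiff_single add_0 mult_ac)
  qed simp
  then show "act (wterm c 0 0 * P) f = act (P * wterm c 0 0) f"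
    by (simp only: act_mult act_wterm pdiff_zero_order act_def[of P] sum_distrib_left mult_ac)
qed

lemma wx_mult_wterm: "wx i * wterm c \<alpha> \<beta> = wterm c (unit_exp i + \<alpha>) \<beta>"
  by (rule act_eqI) (simp add: act_mult act_wterm mult.assoc[symmetric] mult_single)

lemma wterm_mult_wd: "wterm c \<alpha> \<beta> * wd i = wterm c \<alpha> (\<beta> + unit_exp i)"
  by (rule act_eqI) (simp add: act_mult act_wterm pdiff_pdiff)

lemma wx_commute: "wx i * wx j = wx j * wx i"
  by (simp add: wx_mult_wterm add.commute)

lemma wd_commute: "wd i * wd j = wd j * wd i"
  by (simp add: wterm_mult_wd add.commute)

lemma mfact_unit_exp [simp]: "mfact (unit_exp i) = 1"
  unfolding mfact_def by (rule prod.neutral) (simp add: unit_exp_def)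

lemma mchoose_unit_exp [simp]: "mchoose \<mu> (unit_exp i) = \<mu> i"
proof -
  have "mchoose \<mu> (unit_exp i) = (\<Prod>j\<in>UNIV. if j = i then \<mu> j else 1)"
    unfolding mchoose_def by (rule prod.cong) (auto simp: unit_exp_def)
  then show ?thesis by simp
qed

lemma wd_wx: "wd i * wx j = wx j * wd i + (if i = j then 1 else 0)"
proof (rule act_eqI)
  fix f :: "('a, 'b) mpoly"
  have *: "unit_exp j + (\<mu> - unit_exp i) = unit_exp j + \<mu> - unit_exp i" if "\<mu> i \<noteq> 0" for \<mu>
    using that by (auto simp: fun_eq_iff unit_exp_def)
  show "act (wd i * wx j) f = act (wx j * wd i + (if i = j then 1 else 0)) f"
  proof (induction f rule: pm_induct)
    case (single \<mu> c)
    let ?s = "\<lambda>\<mu>. Poly_Mapping.single \<mu> :: 'a \<Rightarrow> ('a, 'b) mpoly"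
    have 1: "act (wd i * wx j) (?s \<mu> c)
        = ?s (unit_exp j + \<mu> - unit_exp i) (of_nat ((unit_exp j + \<mu>) i) * c)"
      unfolding act_mult act_wterm pdiff_zero_order
      by (simp only: mult_single pdiff_single add_0 mult_1 mfact_unit_exp mchoose_unit_exp)
    have 2: "act (wx j * wd i) (?s \<mu> c) = ?s (unit_exp j + (\<mu> - unit_exp i)) (of_nat (\<mu> i) * c)"
      unfolding act_mult act_wterm pdiff_zero_order
      by (simp only: mult_single pdiff_single add_0 mult_1 mfact_unit_exp mchoose_unit_exp)
    have 3: "unit_exp i + \<mu> - unit_exp i = \<mu>"
      by (simp add: fun_eq_iff)
    have "?s (unit_exp j + (\<mu> - unit_exp i)) (of_nat (\<mu> i) * c)
        = ?s (unit_exp j + \<mu> - unit_exp i) (of_nat (\<mu> i) * c)"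
      using *[of \<mu>] by (cases "\<mu> i = 0") auto
    then have 4: "act (wx j * wd i) (?s \<mu> c)
        = ?s (unit_exp j + \<mu> - unit_exp i) (of_nat (\<mu> i) * c)"
      using 2 by simp
    have ui: "(unit_exp j + \<mu>) i = (if i = j then 1 else 0) + \<mu> i"
      by (simp add: unit_exp_def)
    show ?case
    proof (cases "i = j")
      case True
      have "act (wd i * wx j) (?s \<mu> c) = ?s \<mu> c + ?s \<mu> (of_nat (\<mu> i) * c)"
        unfolding 1 ui
        using True 3 by (simp only: single_add[symmetric] if_True of_nat_add of_nat_1 distrib_right
            mult_1 simp_thms)
      moreover have "act (wx j * wd i) (?s \<mu> c) = ?s \<mu> (of_nat (\<mu> i) * c)"
        using True 4 3 by simp
      ultimately show ?thesis using True by (simp add: act_add add.commute del: zero_fun_apply)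
    next
      case False
      then show ?thesis by (simp only: 1 4 ui act_add if_False add_0 act_0 add_0_right simp_thms)
    qed
  qed (simp_all add: act_add_right)
qed

lemma dcoeffs_sum: "dcoeffs (sum h A) = (\<Sum>a\<in>A. dcoeffs (h a))"
  by (induction A rule: infinite_finite_induct) (simp_all add: zero_weyl_def plus_weyl_def)

lemma Weyl_sum: "Weyl (sum h A) = (\<Sum>a\<in>A. Weyl (h a))"
  by (simp add: dcoeffs_inject[symmetric] dcoeffs_sum)

lemma finite_wcoeff: "finite {m. wcoeff P m \<noteq> 0}"
proof -
  have "{m. wcoeff P m \<noteq> 0} \<subseteq> prod.swap ` (Sigma (Poly_Mapping.keys (dcoeffs P))
      (\<lambda>\<beta>. Poly_Mapping.keys (Poly_Mapping.lookup (dcoeffs P) \<beta>)))"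
    by (force simp: wcoeff_def in_keys_iff split: prod.splits)
  then show ?thesis by (rule finite_subset) auto
qed

lemma weyl_normal_form:
  "P = (\<Sum>(\<alpha>, \<beta>)\<in>{m. wcoeff P m \<noteq> 0}. wterm (wcoeff P (\<alpha>, \<beta>)) \<alpha> \<beta>)"
proof -
  let ?S = "Sigma (Poly_Mapping.keys (dcoeffs P))
      (\<lambda>\<beta>. Poly_Mapping.keys (Poly_Mapping.lookup (dcoeffs P) \<beta>))"
  have "dcoeffs P = (\<Sum>\<beta>\<in>Poly_Mapping.keys (dcoeffs P). Poly_Mapping.single \<beta>
      (\<Sum>\<alpha>\<in>Poly_Mapping.keys (Poly_Mapping.lookup (dcoeffs P) \<beta>).
         Poly_Mapping.single \<alpha> (wcoeff P (\<alpha>, \<beta>))))"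
    by (simp add: wcoeff_def sum_single_keys)
  also have "\<dots> = (\<Sum>\<beta>\<in>Poly_Mapping.keys (dcoeffs P).
      \<Sum>\<alpha>\<in>Poly_Mapping.keys (Poly_Mapping.lookup (dcoeffs P) \<beta>).
         Poly_Mapping.single \<beta> (Poly_Mapping.single \<alpha> (wcoeff P (\<alpha>, \<beta>))))"
    by (simp add: single_sum)
  finally have "P = (\<Sum>\<beta>\<in>Poly_Mapping.keys (dcoeffs P).
      \<Sum>\<alpha>\<in>Poly_Mapping.keys (Poly_Mapping.lookup (dcoeffs P) \<beta>).
         wterm (wcoeff P (\<alpha>, \<beta>)) \<alpha> \<beta>)"
    unfolding wterm_def Weyl_sum[symmetric] by (metis dcoeffs_inverse)
  also have "\<dots> = (\<Sum>(\<beta>, \<alpha>)\<in>?S. wterm (wcoeff P (\<alpha>, \<beta>)) \<alpha> \<beta>)"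
    by (rule sum.Sigma) auto
  also have "\<dots> = (\<Sum>(\<alpha>, \<beta>)\<in>{m. wcoeff P m \<noteq> 0}. wterm (wcoeff P (\<alpha>, \<beta>)) \<alpha> \<beta>)"
    by (rule sum.reindex_bij_witness[of _ prod.swap prod.swap])
       (auto simp: wcoeff_def in_keys_iff)
  finally show ?thesis .
qed


section \<open>Monomial orderings\<close>

text \<open>Orderings are given by their strict part.\<close>

definition monomial_ordering :: "('m::plus \<Rightarrow> 'm \<Rightarrow> bool) \<Rightarrow> bool" where
  "monomial_ordering lt \<longleftrightarrow> transp lt \<and> totalp lt \<and> wfp lt
     \<and> (\<forall>a b c. lt a b \<longrightarrow> lt (a + c) (b + c))"

definition weyl_ordering ::
    "(('n \<Rightarrow> nat) \<Rightarrow> ('n \<Rightarrow> nat) \<Rightarrow> bool) \<Rightarrow> (('n \<Rightarrow> nat) \<Rightarrow> ('n \<Rightarrow> nat) \<Rightarrow> bool)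
     \<Rightarrow> ('n \<Rightarrow> nat) \<times> ('n \<Rightarrow> nat) \<Rightarrow> ('n \<Rightarrow> nat) \<times> ('n \<Rightarrow> nat) \<Rightarrow> bool" where
  "weyl_ordering lt_x lt_d = (\<lambda>(\<alpha>1, \<beta>1) (\<alpha>2, \<beta>2). lt_d \<beta>1 \<beta>2 \<or> \<beta>1 = \<beta>2 \<and> lt_x \<alpha>1 \<alpha>2)"

definition max_wrt :: "('m \<Rightarrow> 'm \<Rightarrow> bool) \<Rightarrow> 'm set \<Rightarrow> 'm" where
  "max_wrt lt S = (THE m. m \<in> S \<and> (\<forall>s\<in>S. s \<noteq> m \<longrightarrow> lt s m))"


section \<open>Groebner bases and Groebner \<open>\<delta>\<close>-bases\<close>

text \<open>
  In a commutative ring the left ideals are the ideals, so \<open>left_ideal hull S\<close> is the left ideal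
  generated by \<open>S\<close> in the Weyl algebra and the ideal generated by \<open>S\<close> in \<open>k[X][\<zeta>]\<close>.
\<close>

definition left_ideal :: "'a::ring_1 set \<Rightarrow> bool" where
  "left_ideal I \<longleftrightarrow> 0 \<in> I \<and> (\<forall>a\<in>I. \<forall>b\<in>I. a + b \<in> I) \<and> (\<forall>r. \<forall>a\<in>I. r * a \<in> I)"

definition lead_exp :: "(('n \<Rightarrow> nat) \<times> ('n \<Rightarrow> nat) \<Rightarrow> ('n \<Rightarrow> nat) \<times> ('n \<Rightarrow> nat) \<Rightarrow> bool)
    \<Rightarrow> ('k::field_char_0, 'n::finite) weyl \<Rightarrow> ('n \<Rightarrow> nat) \<times> ('n \<Rightarrow> nat)" where
  "lead_exp lt P = max_wrt lt {m. wcoeff P m \<noteq> 0}"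

definition groebner_base :: "(('n \<Rightarrow> nat) \<times> ('n \<Rightarrow> nat) \<Rightarrow> ('n \<Rightarrow> nat) \<times> ('n \<Rightarrow> nat) \<Rightarrow> bool)
    \<Rightarrow> ('k::field_char_0, 'n::finite) weyl set \<Rightarrow> ('k, 'n) weyl set \<Rightarrow> bool" where
  "groebner_base lt I G \<longleftrightarrow> finite G \<and> G \<subseteq> I \<and> 0 \<notin> G
     \<and> lead_exp lt ` (I - {0}) = (\<Union>P\<in>G. range (\<lambda>m. lead_exp lt P + m))"

definition dexp :: "(('n \<Rightarrow> nat) \<Rightarrow> ('n \<Rightarrow> nat) \<Rightarrow> bool)
    \<Rightarrow> ('k::field_char_0, 'n::finite) weyl \<Rightarrow> 'n \<Rightarrow> nat" where
  "dexp lt_d P = max_wrt lt_d {\<beta>. Poly_Mapping.lookup (dcoeffs P) \<beta> \<noteq> 0}"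

definition dlead_coeff :: "(('n \<Rightarrow> nat) \<Rightarrow> ('n \<Rightarrow> nat) \<Rightarrow> bool)
    \<Rightarrow> ('k::field_char_0, 'n::finite) weyl \<Rightarrow> ('k, 'n) mpoly" where
  "dlead_coeff lt_d P = Poly_Mapping.lookup (dcoeffs P) (dexp lt_d P)"

definition dinitial :: "(('n \<Rightarrow> nat) \<Rightarrow> ('n \<Rightarrow> nat) \<Rightarrow> bool)
    \<Rightarrow> ('k::field_char_0, 'n::finite) weyl \<Rightarrow> ('k, 'n) mpoly2" where
  "dinitial lt_d P = Poly_Mapping.single (dexp lt_d P) (dlead_coeff lt_d P)"

definition groebner_delta_base :: "(('n \<Rightarrow> nat) \<Rightarrow> ('n \<Rightarrow> nat) \<Rightarrow> bool)
    \<Rightarrow> ('k::field_char_0, 'n::finite) weyl set \<Rightarrow> ('k, 'n) weyl set \<Rightarrow> bool" where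
  "groebner_delta_base lt_d I G \<longleftrightarrow> finite G \<and> G \<subseteq> I \<and> 0 \<notin> G
     \<and> left_ideal hull (dinitial lt_d ` (I - {0})) = left_ideal hull (dinitial lt_d ` G)"

end

theory Submission
  imports Defs
begin

text \<open>
  For the ordering \<open>weyl_ordering lt_x lt_d\<close> the leading exponent of an
  operator \<open>P\<close> consists of the exponent of its \<open>\<delta>\<close>-initial form and the \<open>lt_x\<close>-leading exponent
  of the coefficient of that form. A single step of the division algorithm, subtracting from \<open>P\<close>
  a suitable multiple \<open>c X\<^sup>a \<partial>\<^sup>b Q\<close> of some \<open>Q \<in> G\<close>, therefore acts on initial forms as follows.
  The commutators created by moving \<open>\<partial>\<^sup>b\<close> past the coefficients of \<open>Q\<close> have strictly smaller
  order in \<open>\<partial>\<close>, so the product has initial form \<open>c X\<^sup>a \<zeta>\<^sup>b\<close> times that of \<open>Q\<close>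
  (\<open>lookup_wterm_mult_dexp\<close> and \<open>wterm_mult_below_dexp\<close>). If the remainder \<open>R\<close> still has the
  \<open>\<delta>\<close>-exponent of \<open>P\<close>, then the initial form of \<open>P\<close> is the sum of this multiple and the initial
  form of \<open>R\<close>; otherwise it is equal to this multiple (\<open>division_step\<close>). Since the remainder has a
  smaller leading exponent and stays in the left ideal, well-founded induction on the leading
  exponent writes every initial form as a combination of the initial forms of \<open>G\<close>
  (\<open>dinitial_in_hull\<close>).
\<close>

section \<open>Monomial orderings and maxima\<close>

lemma monomial_ordering_irrefl: "monomial_ordering lt \<Longrightarrow> \<not> lt a a"
  unfolding monomial_ordering_def by (meson wfp_imp_irreflp irreflpD)

lemma monomial_ordering_trans: "monomial_ordering lt \<Longrightarrow> lt a b \<Longrightarrow> lt b c \<Longrightarrow> lt a c"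
  unfolding monomial_ordering_def by (meson transpD)

lemma monomial_ordering_total: "monomial_ordering lt \<Longrightarrow> a \<noteq> b \<Longrightarrow> lt a b \<or> lt b a"
  unfolding monomial_ordering_def totalp_on_def by simp

text \<open>
  If some exponent were below \<open>0\<close>, a minimal such \<open>z\<close> would be contradicted by \<open>z + z\<close>, which lies
  below \<open>z\<close> by compatibility with addition.
\<close>

lemma monomial_ordering_zero_least:
  fixes m :: "'m::monoid_add"
  assumes lt: "monomial_ordering lt" and "m \<noteq> 0"
  shows "lt 0 m"
proof (rule ccontr)
  assume "\<not> lt 0 m"
  then have "lt m 0" using monomial_ordering_total[OF lt \<open>m \<noteq> 0\<close>] by blast
  moreover have "wfp lt" using lt by (simp add: monomial_ordering_def)
  ultimately obtain z where z: "lt z 0" "\<And>y. lt y z \<Longrightarrow> \<not> lt y 0"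
    unfolding wfp_iff_ex_minimal by (auto elim!: allE[of _ "{m. lt m 0}"])
  have "lt (z + z) (0 + z)" using lt z(1) unfolding monomial_ordering_def by blast
  then have "lt (z + z) z" by simp
  then show False using z monomial_ordering_trans[OF lt] by blast
qed

lemma weyl_ordering_monomial_ordering:
  assumes "monomial_ordering lt_x" "monomial_ordering lt_d"
  shows "monomial_ordering (weyl_ordering lt_x lt_d)"
  unfolding monomial_ordering_def
proof (intro conjI)
  show "transp (weyl_ordering lt_x lt_d)"
    using monomial_ordering_trans[OF assms(1)] monomial_ordering_trans[OF assms(2)]
    unfolding transp_def weyl_ordering_def split_paired_All prod.case by blast
  show "totalp (weyl_ordering lt_x lt_d)"
    using monomial_ordering_total[OF assms(1)] monomial_ordering_total[OF assms(2)]
    by (simp add: totalp_on_def weyl_ordering_def) blast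
  have "wf ({(a, b). lt_d a b} <*lex*> {(a, b). lt_x a b})"
    using assms by (intro wf_lex_prod) (auto simp: monomial_ordering_def wfp_def)
  then have "wf (inv_image ({(a, b). lt_d a b} <*lex*> {(a, b). lt_x a b}) prod.swap)"
    by (rule wf_inv_image)
  also have "inv_image ({(a, b). lt_d a b} <*lex*> {(a, b). lt_x a b}) prod.swap
      = {(m, m'). weyl_ordering lt_x lt_d m m'}"
    by (auto simp: inv_image_def weyl_ordering_def)
  finally show "wfp (weyl_ordering lt_x lt_d)" by (simp add: wfp_def)
  show "\<forall>a b c. weyl_ordering lt_x lt_d a b \<longrightarrow> weyl_ordering lt_x lt_d (a + c) (b + c)"
    using assms by (auto simp: weyl_ordering_def monomial_ordering_def)
qed

lemma max_wrt_eqI: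
  assumes lt: "monomial_ordering lt" and "m \<in> S" "\<And>s. s \<in> S \<Longrightarrow> s \<noteq> m \<Longrightarrow> lt s m"
  shows "max_wrt lt S = m"
  unfolding max_wrt_def
proof (rule the_equality)
  fix m' assume m': "m' \<in> S \<and> (\<forall>s\<in>S. s \<noteq> m' \<longrightarrow> lt s m')"
  show "m' = m"
  proof (rule ccontr)
    assume "m' \<noteq> m"
    with m' assms(2,3) have "lt m m'" "lt m' m" by auto
    then show False using monomial_ordering_irrefl[OF lt] monomial_ordering_trans[OF lt] by blast
  qed
qed (use assms in blast)

lemma max_wrt_finite:
  assumes lt: "monomial_ordering lt" and S: "finite S" "S \<noteq> {}"
  shows max_wrt_in: "max_wrt lt S \<in> S"
    and less_max_wrt: "\<And>s. s \<in> S \<Longrightarrow> s \<noteq> max_wrt lt S \<Longrightarrow> lt s (max_wrt lt S)"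
proof -
  from S have "\<exists>m\<in>S. \<forall>s\<in>S. s \<noteq> m \<longrightarrow> lt s m"
  proof (induction rule: finite_ne_induct)
    case (insert x F)
    then show ?case
      by (metis insert_iff monomial_ordering_total[OF lt] monomial_ordering_trans[OF lt])
  qed simp
  then obtain m where m: "m \<in> S" "\<And>s. s \<in> S \<Longrightarrow> s \<noteq> m \<Longrightarrow> lt s m" by blast
  with max_wrt_eqI[OF lt] have "max_wrt lt S = m" by blast
  with m show "max_wrt lt S \<in> S" "\<And>s. s \<in> S \<Longrightarrow> s \<noteq> max_wrt lt S \<Longrightarrow> lt s (max_wrt lt S)"
    by auto
qed


section \<open>Leading exponents of operators\<close>

lemma dcoeffs_eq_0_iff: "dcoeffs P = 0 \<longleftrightarrow> P = 0"
  by (metis dcoeffs_inverse dcoeffs_Weyl zero_weyl_def)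

lemma lookup_dexp:
  assumes "monomial_ordering lt_d" "P \<noteq> 0"
  shows dlead_coeff_nonzero: "dlead_coeff lt_d P \<noteq> 0"
    and less_dexp: "\<And>\<beta>. Poly_Mapping.lookup (dcoeffs P) \<beta> \<noteq> 0 \<Longrightarrow> \<beta> \<noteq> dexp lt_d P
      \<Longrightarrow> lt_d \<beta> (dexp lt_d P)"
proof -
  let ?S = "{\<beta>. Poly_Mapping.lookup (dcoeffs P) \<beta> \<noteq> 0}"
  have "?S = Poly_Mapping.keys (dcoeffs P)" by (auto simp: in_keys_iff)
  with assms(2) have S: "finite ?S" "?S \<noteq> {}" by (auto simp: dcoeffs_eq_0_iff)
  show "dlead_coeff lt_d P \<noteq> 0"
    using max_wrt_in[OF assms(1) S] by (simp add: dlead_coeff_def dexp_def)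
  show "\<And>\<beta>. Poly_Mapping.lookup (dcoeffs P) \<beta> \<noteq> 0 \<Longrightarrow> \<beta> \<noteq> dexp lt_d P
      \<Longrightarrow> lt_d \<beta> (dexp lt_d P)"
    using less_max_wrt[OF assms(1) S] by (simp add: dexp_def)
qed

text \<open>
  The second component of the leading exponent only sees the powers of \<open>\<partial>\<close>, because \<open>lt_x\<close> is
  consulted only for ties.
\<close>

lemma wcoeff_lead_exp:
  assumes "monomial_ordering lt_x" "monomial_ordering lt_d" "P \<noteq> 0"
  shows wcoeff_lead_exp_nonzero: "wcoeff P (lead_exp (weyl_ordering lt_x lt_d) P) \<noteq> 0"
    and less_lead_exp: "\<And>m. wcoeff P m \<noteq> 0 \<Longrightarrow> m \<noteq> lead_exp (weyl_ordering lt_x lt_d) P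
      \<Longrightarrow> weyl_ordering lt_x lt_d m (lead_exp (weyl_ordering lt_x lt_d) P)"
    and snd_lead_exp: "snd (lead_exp (weyl_ordering lt_x lt_d) P) = dexp lt_d P"
proof -
  let ?lt = "weyl_ordering lt_x lt_d" and ?S = "{m. wcoeff P m \<noteq> 0}"
  let ?\<beta> = "dexp lt_d P"
  note lt = weyl_ordering_monomial_ordering[OF assms(1,2)]
  obtain \<alpha> where \<alpha>: "wcoeff P (\<alpha>, ?\<beta>) \<noteq> 0"
    using dlead_coeff_nonzero[OF assms(2,3)]
    by (force simp: wcoeff_def dlead_coeff_def poly_mapping_eq_iff fun_eq_iff)
  then have S: "finite ?S" "?S \<noteq> {}" using finite_wcoeff by auto
  from max_wrt_in[OF lt S] show in_S: "wcoeff P (lead_exp ?lt P) \<noteq> 0" by (simp add: lead_exp_def)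
  from less_max_wrt[OF lt S] show less: "\<And>m. wcoeff P m \<noteq> 0 \<Longrightarrow> m \<noteq> lead_exp ?lt P
      \<Longrightarrow> ?lt m (lead_exp ?lt P)" by (simp add: lead_exp_def)
  obtain \<alpha>' \<beta>' where eq: "lead_exp ?lt P = (\<alpha>', \<beta>')" by fastforce
  have "Poly_Mapping.lookup (dcoeffs P) \<beta>' \<noteq> 0" using in_S eq by (auto simp: wcoeff_def)
  then have "\<beta>' = ?\<beta> \<or> lt_d \<beta>' ?\<beta>" using less_dexp[OF assms(2,3)] by blast
  moreover have "?\<beta> = \<beta>' \<or> lt_d ?\<beta> \<beta>'" using less[OF \<alpha>] eq by (auto simp: weyl_ordering_def)
  ultimately show "snd (lead_exp ?lt P) = ?\<beta>"
    using eq monomial_ordering_irrefl[OF assms(2)] monomial_ordering_trans[OF assms(2)]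
    by (metis snd_conv)
qed


section \<open>Multiplication by a term\<close>

lemma single_mult_eq_sum:
  "Poly_Mapping.single a c * q
     = (\<Sum>\<mu>\<in>Poly_Mapping.keys q. Poly_Mapping.single (a + \<mu>) (c * Poly_Mapping.lookup q \<mu>))"
proof -
  have "Poly_Mapping.single a c * q = Poly_Mapping.single a c
      * (\<Sum>\<mu>\<in>Poly_Mapping.keys q. Poly_Mapping.single \<mu> (Poly_Mapping.lookup q \<mu>))"
    by (simp only: sum_single_keys)
  then show ?thesis by (simp only: sum_distrib_left mult_single)
qed

lemma lookup_single_mult_shift:
  fixes q :: "('n \<Rightarrow> nat) \<Rightarrow>\<^sub>0 'b::semiring_0"
  shows "Poly_Mapping.lookup (Poly_Mapping.single a c * q) (a + \<mu>) = c * Poly_Mapping.lookup q \<mu>"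
  unfolding single_mult_eq_sum
  by (auto simp: lookup_sum lookup_single when_def in_keys_iff)

lemma lookup_single_mult_nonzero:
  fixes q :: "'m::monoid_add \<Rightarrow>\<^sub>0 'b::semiring_0"
  assumes "Poly_Mapping.lookup (Poly_Mapping.single a c * q) \<nu> \<noteq> 0"
  obtains \<mu> where "\<nu> = a + \<mu>" "Poly_Mapping.lookup q \<mu> \<noteq> 0"
proof -
  have "\<exists>\<mu>\<in>Poly_Mapping.keys q. a + \<mu> = \<nu>"
  proof (rule ccontr)
    assume "\<not> ?thesis"
    then have "Poly_Mapping.lookup (Poly_Mapping.single a c * q) \<nu> = 0"
      unfolding single_mult_eq_sum lookup_sum
      by (intro sum.neutral) (auto simp: lookup_single when_def)
    with assms show False by contradiction
  qed
  then show ?thesis using that by (auto simp: in_keys_iff)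
qed

lemma dcoeffs_wterm_mult:
  "dcoeffs (wterm c a b * Q) = (\<Sum>\<gamma>\<in>Poly_Mapping.keys (dcoeffs Q). \<Sum>\<sigma>\<in>{..b}.
     Poly_Mapping.single (b - \<sigma> + \<gamma>) (of_nat (mchoose b \<sigma>) * Poly_Mapping.single a c
       * pdiff \<sigma> (Poly_Mapping.lookup (dcoeffs Q) \<gamma>)))"
  unfolding times_weyl_def dcoeffs_Weyl wterm_def
  by (rule sum_keys_single) simp

text \<open>
  In the product of \<open>c X\<^sup>a \<partial>\<^sup>b\<close> with an operator of order \<open>\<gamma>'\<close>, the exponent \<open>b - \<sigma> + \<gamma>\<close> belongs to
  the terms in which \<open>\<partial>\<^sup>\<sigma>\<close> has been spent on differentiating the coefficient of \<open>\<partial>\<^sup>\<gamma>\<close>. Only the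
  undifferentiated leading term, with \<open>\<sigma> = 0\<close> and \<open>\<gamma> = \<gamma>'\<close>, reaches the top order \<open>b + \<gamma>'\<close>: spending
  \<open>\<sigma> \<noteq> 0\<close> lowers the order because \<open>0\<close> is the least exponent.
\<close>

lemma wterm_mult_order_less:
  fixes b \<sigma> \<gamma> \<gamma>' :: "'n \<Rightarrow> nat"
  assumes lt: "monomial_ordering lt_d" and "\<sigma> \<le> b" and \<gamma>: "\<gamma> = \<gamma>' \<or> lt_d \<gamma> \<gamma>'"
    and ne: "\<not> (\<sigma> = 0 \<and> \<gamma> = \<gamma>')"
  shows "lt_d (b - \<sigma> + \<gamma>) (b + \<gamma>')"
proof -
  have shift: "lt_d u v \<Longrightarrow> lt_d (u + w) (v + w)" for u v w
    using lt by (simp add: monomial_ordering_def)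
  have 1: "\<sigma> + (b - \<sigma> + \<gamma>) = b + \<gamma>"
  proof
    show "(\<sigma> + (b - \<sigma> + \<gamma>)) i = (b + \<gamma>) i" for i
      using le_funD[OF \<open>\<sigma> \<le> b\<close>, of i] by simp
  qed
  have 2: "lt_d (b - \<sigma> + \<gamma>) (b + \<gamma>)" if "\<sigma> \<noteq> 0"
    using shift[OF monomial_ordering_zero_least[OF lt that], of "b - \<sigma> + \<gamma>"] 1 by simp
  have 3: "lt_d (b + \<gamma>) (b + \<gamma>')" if "\<gamma> \<noteq> \<gamma>'"
    using \<gamma> that shift[of \<gamma> \<gamma>' b] by (simp add: add.commute)
  show ?thesis
  proof (cases "\<sigma> = 0")
    case True
    have "b - 0 + \<gamma> = b + \<gamma>" by (simp add: fun_eq_iff)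
    with 3 ne True show ?thesis by simp
  next
    case False
    with 2 3 monomial_ordering_trans[OF lt] show ?thesis by (cases "\<gamma> = \<gamma>'") blast+
  qed
qed

lemma lookup_wterm_mult_dexp:
  assumes lt: "monomial_ordering lt_d" and "Q \<noteq> 0"
  shows "Poly_Mapping.lookup (dcoeffs (wterm c a b * Q)) (b + dexp lt_d Q)
    = Poly_Mapping.single a c * dlead_coeff lt_d Q"
proof -
  let ?K = "Poly_Mapping.keys (dcoeffs Q)" and ?\<gamma> = "dexp lt_d Q"
  let ?t = "\<lambda>\<gamma> \<sigma>. of_nat (mchoose b \<sigma>) * Poly_Mapping.single a c
       * pdiff \<sigma> (Poly_Mapping.lookup (dcoeffs Q) \<gamma>)"
  have K: "?\<gamma> \<in> ?K"
    using dlead_coeff_nonzero[OF assms] by (simp add: dlead_coeff_def in_keys_iff)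
  have other: "b - \<sigma> + \<gamma> \<noteq> b + ?\<gamma>" if "\<gamma> \<in> ?K" "\<sigma> \<le> b" "\<not> (\<sigma> = 0 \<and> \<gamma> = ?\<gamma>)" for \<gamma> \<sigma>
    using wterm_mult_order_less[OF lt that(2) _ that(3)] less_dexp[OF assms, of \<gamma>] that(1)
      monomial_ordering_irrefl[OF lt] by (metis in_keys_iff)
  have "Poly_Mapping.lookup (dcoeffs (wterm c a b * Q)) (b + ?\<gamma>)
      = (\<Sum>\<gamma>\<in>?K. \<Sum>\<sigma>\<in>{..b}. if \<gamma> = ?\<gamma> then if \<sigma> = 0 then ?t \<gamma> \<sigma> else 0 else 0)"
    unfolding dcoeffs_wterm_mult lookup_sum
  proof (intro sum.cong refl)
    fix \<gamma> \<sigma> assume "\<gamma> \<in> ?K" "\<sigma> \<in> {..b}"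
    moreover have "b - 0 + ?\<gamma> = b + ?\<gamma>" by (simp add: fun_eq_iff)
    ultimately show "Poly_Mapping.lookup (Poly_Mapping.single (b - \<sigma> + \<gamma>) (?t \<gamma> \<sigma>)) (b + ?\<gamma>)
        = (if \<gamma> = ?\<gamma> then if \<sigma> = 0 then ?t \<gamma> \<sigma> else 0 else 0)"
      using other[of \<gamma> \<sigma>] unfolding lookup_single when_def by auto
  qed
  also have "\<dots> = (\<Sum>\<gamma>\<in>?K. if \<gamma> = ?\<gamma> then \<Sum>\<sigma>\<in>{..b}. if \<sigma> = 0 then ?t \<gamma> \<sigma> else 0 else 0)"
    by (intro sum.cong) auto
  also have "\<dots> = ?t ?\<gamma> 0"
    using K by (simp add: sum.delta finite_atMost_fun le_fun_def)
  finally show ?thesis by (simp add: dlead_coeff_def mchoose_def)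
qed

lemma wterm_mult_below_dexp:
  assumes lt: "monomial_ordering lt_d" and "Q \<noteq> 0"
    and nz: "Poly_Mapping.lookup (dcoeffs (wterm c a b * Q)) \<delta> \<noteq> 0"
    and ne: "\<delta> \<noteq> b + dexp lt_d Q"
  shows "lt_d \<delta> (b + dexp lt_d Q)"
proof -
  obtain \<gamma> \<sigma> where \<gamma>: "\<gamma> \<in> Poly_Mapping.keys (dcoeffs Q)" and \<sigma>: "\<sigma> \<le> b"
    and \<delta>: "\<delta> = b - \<sigma> + \<gamma>"
  proof (rule ccontr)
    assume "\<not> thesis"
    with that have "\<And>\<gamma> \<sigma>. \<gamma> \<in> Poly_Mapping.keys (dcoeffs Q) \<Longrightarrow> \<sigma> \<le> b \<Longrightarrow> b - \<sigma> + \<gamma> \<noteq> \<delta>"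
      by blast
    then have "Poly_Mapping.lookup (dcoeffs (wterm c a b * Q)) \<delta> = 0"
      unfolding dcoeffs_wterm_mult lookup_sum
      by (intro sum.neutral ballI) (auto simp: lookup_single when_def)
    with nz show False by contradiction
  qed
  have "\<not> (\<sigma> = 0 \<and> \<gamma> = dexp lt_d Q)" using ne \<delta> by (auto simp: fun_eq_iff)
  with wterm_mult_order_less[OF lt \<sigma>] less_dexp[OF assms(1,2), of \<gamma>] \<gamma> show ?thesis
    unfolding \<delta> by (metis in_keys_iff)
qed


section \<open>Division and initial forms\<close>

text \<open>
  In a division step \<open>\<beta>\<close> is the order of the dividend. If the component of order \<open>\<beta>\<close> of the
  remainder \<open>R\<close> survives, it is the leading one, since nothing in \<open>R\<close> has a larger order.
\<close>

lemma dinitial_dichotomy: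
  assumes "monomial_ordering lt_d" "R \<noteq> 0"
    and below: "\<And>\<delta>. Poly_Mapping.lookup (dcoeffs R) \<delta> \<noteq> 0 \<Longrightarrow> \<delta> \<noteq> \<beta> \<Longrightarrow> lt_d \<delta> \<beta>"
  shows "Poly_Mapping.single \<beta> (Poly_Mapping.lookup (dcoeffs R) \<beta>) \<in> {0, dinitial lt_d R}"
proof (cases "Poly_Mapping.lookup (dcoeffs R) \<beta> = 0")
  case False
  then have "dexp lt_d R = \<beta>"
    unfolding dexp_def using below by (intro max_wrt_eqI[OF assms(1)]) auto
  then show ?thesis by (simp add: dinitial_def dlead_coeff_def)
qed simp

text \<open>
  Here \<open>S = c X\<^sup>a \<partial>\<^sup>b\<close>, where \<open>(a, b)\<close> is the difference of the leading exponents and \<open>c\<close> the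
  quotient of the leading coefficients, and \<open>f = c X\<^sup>a \<zeta>\<^sup>b\<close> is its initial form. Comparing the
  components of order \<open>dexp lt_d P\<close> in \<open>P = S * Q + R\<close> gives the relation between initial forms.
\<close>

lemma division_step:
  fixes P Q :: "('k::field_char_0, 'n::finite) weyl"
  assumes lx: "monomial_ordering lt_x" and ld: "monomial_ordering lt_d"
    and P: "P \<noteq> 0" and Q: "Q \<noteq> 0"
    and div: "lead_exp (weyl_ordering lt_x lt_d) P = lead_exp (weyl_ordering lt_x lt_d) Q + m"
  obtains S f where
    "P - S * Q \<noteq> 0 \<Longrightarrow> weyl_ordering lt_x lt_d
       (lead_exp (weyl_ordering lt_x lt_d) (P - S * Q)) (lead_exp (weyl_ordering lt_x lt_d) P)"
    "dinitial lt_d P = f * dinitial lt_d Q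
       \<or> P - S * Q \<noteq> 0 \<and> dinitial lt_d P = f * dinitial lt_d Q + dinitial lt_d (P - S * Q)"
proof -
  let ?lt = "weyl_ordering lt_x lt_d"
  obtain a b where m: "m = (a, b)" by fastforce
  obtain \<alpha> where \<alpha>: "lead_exp ?lt Q = (\<alpha>, dexp lt_d Q)"
    using snd_lead_exp[OF lx ld Q] by (metis prod.collapse)
  have P_lead: "lead_exp ?lt P = (a + \<alpha>, b + dexp lt_d Q)"
    using div \<alpha> m by (simp add: add.commute)
  have dexp_P: "dexp lt_d P = b + dexp lt_d Q"
    using snd_lead_exp[OF lx ld P] P_lead by simp
  define c where "c = wcoeff P (lead_exp ?lt P) / wcoeff Q (lead_exp ?lt Q)"
  define S where "S = wterm c a b"
  define f :: "('k, 'n) mpoly2" where "f = Poly_Mapping.single b (Poly_Mapping.single a c)"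
  define R where "R = P - S * Q"
  have look_R: "Poly_Mapping.lookup (dcoeffs R) \<delta>
      = Poly_Mapping.lookup (dcoeffs P) \<delta> - Poly_Mapping.lookup (dcoeffs (S * Q)) \<delta>" for \<delta>
    by (simp add: R_def minus_weyl_def lookup_minus)
  have top_R: "Poly_Mapping.lookup (dcoeffs R) (dexp lt_d P)
      = dlead_coeff lt_d P - Poly_Mapping.single a c * dlead_coeff lt_d Q"
    using lookup_wterm_mult_dexp[OF ld Q, of c a b]
    by (simp add: look_R S_def dexp_P dlead_coeff_def)
  have below: "lt_d \<delta> (dexp lt_d P)"
    if "Poly_Mapping.lookup (dcoeffs R) \<delta> \<noteq> 0" "\<delta> \<noteq> dexp lt_d P" for \<delta>
  proof -
    have "Poly_Mapping.lookup (dcoeffs P) \<delta> \<noteq> 0 \<or> Poly_Mapping.lookup (dcoeffs (S * Q)) \<delta> \<noteq> 0"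
      using that(1) look_R[of \<delta>] by auto
    then show ?thesis
      using less_dexp[OF ld P] wterm_mult_below_dexp[OF ld Q, of c a b \<delta>] that(2)
      unfolding S_def dexp_P by blast
  qed
  have less: "?lt n (lead_exp ?lt P)" if n: "wcoeff R n \<noteq> 0" for n
  proof -
    obtain \<nu> \<delta> where n_eq: "n = (\<nu>, \<delta>)" by fastforce
    show ?thesis
    proof (cases "\<delta> = dexp lt_d P")
      case False
      have "Poly_Mapping.lookup (dcoeffs R) \<delta> \<noteq> 0" using n n_eq by (auto simp: wcoeff_def)
      from below[OF this False] show ?thesis
        unfolding n_eq P_lead dexp_P by (simp add: weyl_ordering_def)
    next
      case True
      let ?p = "dlead_coeff lt_d P" and ?q = "dlead_coeff lt_d Q"
      have \<nu>: "Poly_Mapping.lookup ?p \<nu> - Poly_Mapping.lookup (Poly_Mapping.single a c * ?q) \<nu> \<noteq> 0"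
        using n n_eq True top_R by (simp add: wcoeff_def lookup_minus)
      have lc_P: "wcoeff P (lead_exp ?lt P) = Poly_Mapping.lookup ?p (a + \<alpha>)"
        using P_lead dexp_P by (simp add: wcoeff_def dlead_coeff_def)
      have lc_Q: "wcoeff Q (lead_exp ?lt Q) = Poly_Mapping.lookup ?q \<alpha>"
        using \<alpha> by (simp add: wcoeff_def dlead_coeff_def)
      \<comment> \<open>The choice of \<open>c\<close> cancels the leading term.\<close>
      have "\<nu> \<noteq> a + \<alpha>"
      proof
        assume "\<nu> = a + \<alpha>"
        with \<nu> have "Poly_Mapping.lookup ?p (a + \<alpha>) - c * Poly_Mapping.lookup ?q \<alpha> \<noteq> 0"
          by (simp only: lookup_single_mult_shift not_False_eq_True)
        then show False
          using wcoeff_lead_exp_nonzero[OF lx ld Q] by (simp add: c_def lc_P lc_Q)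
      qed
      consider "Poly_Mapping.lookup ?p \<nu> \<noteq> 0"
        | "Poly_Mapping.lookup (Poly_Mapping.single a c * ?q) \<nu> \<noteq> 0"
        using \<nu> by fastforce
      then have "lt_x \<nu> (a + \<alpha>)"
      proof cases
        case 1
        then have "wcoeff P (\<nu>, dexp lt_d P) \<noteq> 0" by (simp add: wcoeff_def dlead_coeff_def)
        from less_lead_exp[OF lx ld P this] show ?thesis
          using \<open>\<nu> \<noteq> a + \<alpha>\<close> P_lead dexp_P monomial_ordering_irrefl[OF ld]
          by (auto simp: weyl_ordering_def)
      next
        case 2
        then obtain \<mu> where \<mu>: "\<nu> = a + \<mu>" "Poly_Mapping.lookup ?q \<mu> \<noteq> 0"
          by (rule lookup_single_mult_nonzero)
        then have "wcoeff Q (\<mu>, dexp lt_d Q) \<noteq> 0" by (simp add: wcoeff_def dlead_coeff_def)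
        from less_lead_exp[OF lx ld Q this] have "lt_x \<mu> \<alpha>"
          using \<open>\<nu> \<noteq> a + \<alpha>\<close> \<alpha> \<mu>(1) monomial_ordering_irrefl[OF ld]
          by (auto simp: weyl_ordering_def)
        then have "lt_x (\<mu> + a) (\<alpha> + a)" using lx by (simp add: monomial_ordering_def)
        then show ?thesis using \<mu>(1) by (simp add: add.commute)
      qed
      then show ?thesis unfolding n_eq P_lead using True dexp_P by (simp add: weyl_ordering_def)
    qed
  qed
  have "dinitial lt_d P = f * dinitial lt_d Q
      + Poly_Mapping.single (dexp lt_d P) (Poly_Mapping.lookup (dcoeffs R) (dexp lt_d P))"
    unfolding top_R
    by (simp only: f_def dinitial_def mult_single dexp_P[symmetric] single_add[symmetric]
        add_diff_cancel_left' diff_add_cancel add.commute[of _ "_ - _"])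
  moreover have "Poly_Mapping.lookup (dcoeffs R) (dexp lt_d P) = 0" if "R = 0"
    using that by (simp add: zero_weyl_def)
  ultimately have "dinitial lt_d P = f * dinitial lt_d Q
       \<or> R \<noteq> 0 \<and> dinitial lt_d P = f * dinitial lt_d Q + dinitial lt_d R"
    using dinitial_dichotomy[OF ld _ below] by (cases "R = 0") auto
  moreover have "?lt (lead_exp ?lt R) (lead_exp ?lt P)" if "R \<noteq> 0"
    using less wcoeff_lead_exp_nonzero[OF lx ld that] by blast
  ultimately show ?thesis using that unfolding R_def by blast
qed

lemma left_ideal_hull: "left_ideal (left_ideal hull S)"
  by (rule hull_in) (auto simp: left_ideal_def)

text \<open>
  Every remainder lies in \<open>I\<close> again, so its leading exponent is also a multiple of some
  leading exponent of \<open>G\<close> and the division can be continued; it stops because the ordering is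
  well-founded.
\<close>

lemma dinitial_in_hull:
  assumes lx: "monomial_ordering lt_x" and ld: "monomial_ordering lt_d" and I: "left_ideal I"
    and G: "groebner_base (weyl_ordering lt_x lt_d) I G"
    and P: "P \<in> I" "P \<noteq> 0"
  shows "dinitial lt_d P \<in> left_ideal hull (dinitial lt_d ` G)"
proof -
  let ?lt = "weyl_ordering lt_x lt_d" and ?J = "left_ideal hull (dinitial lt_d ` G)"
  have "wfp ?lt"
    using weyl_ordering_monomial_ordering[OF lx ld] by (simp add: monomial_ordering_def)
  then have "wfp (\<lambda>P P'. ?lt (lead_exp ?lt P) (lead_exp ?lt P'))"
    by (rule wfp_if_convertible_to_wfp)
  from this P show ?thesis
  proof (induction P rule: wfp_induct_rule)
    case (less P)
    have "lead_exp ?lt P \<in> (\<Union>Q\<in>G. range (\<lambda>m. lead_exp ?lt Q + m))"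
      using G less.prems unfolding groebner_base_def by blast
    then obtain Q m where Q: "Q \<in> G" and div: "lead_exp ?lt P = lead_exp ?lt Q + m" by blast
    have Q': "Q \<in> I" "Q \<noteq> 0" using Q G by (auto simp: groebner_base_def)
    obtain S f where step: "P - S * Q \<noteq> 0 \<Longrightarrow> ?lt (lead_exp ?lt (P - S * Q)) (lead_exp ?lt P)"
      "dinitial lt_d P = f * dinitial lt_d Q
       \<or> P - S * Q \<noteq> 0 \<and> dinitial lt_d P = f * dinitial lt_d Q + dinitial lt_d (P - S * Q)"
      using division_step[OF lx ld less.prems(2) Q'(2) div] by metis
    (* left_ideal speaks of sums only; the difference arises from the multiplier - S *)
    have "P + (- S) * Q \<in> I"
      using I less.prems(1) Q'(1) unfolding left_ideal_def by blast
    then have R: "P - S * Q \<in> I" by simp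
    have "dinitial lt_d Q \<in> ?J" using Q by (intro hull_inc) simp
    then have fQ: "f * dinitial lt_d Q \<in> ?J"
      using left_ideal_hull[of "dinitial lt_d ` G"] unfolding left_ideal_def by blast
    show ?case
      using step(2)
    proof
      assume *: "P - S * Q \<noteq> 0
        \<and> dinitial lt_d P = f * dinitial lt_d Q + dinitial lt_d (P - S * Q)"
      then have "dinitial lt_d (P - S * Q) \<in> ?J" using less.IH step(1) R by blast
      then have "f * dinitial lt_d Q + dinitial lt_d (P - S * Q) \<in> ?J"
        using fQ left_ideal_hull[of "dinitial lt_d ` G"] unfolding left_ideal_def by blast
      with * show ?thesis by (simp only:)
    qed (use fQ in simp)
  qed
qed

theorem theorem26:
  fixes lt_x lt_d :: "('n::finite \<Rightarrow> nat) \<Rightarrow> ('n \<Rightarrow> nat) \<Rightarrow> bool"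
    and I G :: "('k::field_char_0, 'n) weyl set"
  assumes "monomial_ordering lt_x" and "monomial_ordering lt_d"
    and "left_ideal I" and "I \<noteq> {0}"
    and "finite G" and "0 \<notin> G" and "left_ideal hull G = I"
    and "groebner_base (weyl_ordering lt_x lt_d) I G"
  shows "groebner_delta_base lt_d I G"
proof -
  have GI: "G \<subseteq> I" using assms(8) by (simp add: groebner_base_def)
  have "left_ideal hull (dinitial lt_d ` (I - {0})) = left_ideal hull (dinitial lt_d ` G)"
  proof
    show "left_ideal hull (dinitial lt_d ` (I - {0})) \<subseteq> left_ideal hull (dinitial lt_d ` G)"
      using dinitial_in_hull[OF assms(1-3,8)] left_ideal_hull by (intro hull_minimal) auto
    show "left_ideal hull (dinitial lt_d ` G) \<subseteq> left_ideal hull (dinitial lt_d ` (I - {0}))"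
      using GI assms(6) by (intro hull_mono) blast
  qed
  then show ?thesis using GI assms(5,6) by (simp add: groebner_delta_base_def)
qed

end
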